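(* Let $n_1$ and $n_2$ be two positive integers such that $$ \left\{ \begin{array}{ll} \mathrm{rad}(n_1)\mid n_2\ \text{and}\ n_2\mid n_1, & \text{if}\ v_2(n_1)\leq 1;\\ 2\,\mathrm{rad}(n_1)\mid n_2\ \text{and}\ n_2\mid n_1, & \text{if}\ v_2(n_1)\geq 2. \end{array} \right. $$ Then, for every integer $a$ coprime to $n_1$ and $n_2$, we have $$ \alpha_{n_1}(a) = \frac{\alpha_{n_2}(a)}{\gcd\left(\alpha_{n_2}(a),\frac{\gcd(n_1,\mathcal{R}_{n_2}(a))}{n_2}\right)}. $$
   Context: For a prime $p$ and a positive integer $n$, $v_p(n)$ is the $p$-adic valuation of $n$, and $\mathrm{rad}(n)=\prod_{p\mid n,\ p\text{ prime}}p$ is the largest square-free divisor of $n$. For an integer $a$ coprime to a positive integer $n$, $\mathcal{O}_n(a)$ is the multiplicative order of $a$ modulo $n$, i.e. the smallest positive integer $e$ with $a^e\equiv 1\pmod n$, and $\mathcal{R}_n(a)=a^{\mathcal{O}_n(a)}-1$ (an integer, multiple of $n$). The function $\alpha_n:\mathbb{Z}\to\mathbb{N}$ is defined by $\alpha_n(a)=\mathcal{O}_n(a^n)$ if $\gcd(a,n)=1$, and $\alpha_n(a)=0$ otherwise. Convention: $\gcd(0,n)=n$. *)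

theory Defs
  imports "HOL-Number_Theory.Number_Theory"
begin

definition rad :: "nat \<Rightarrow> nat"
  where "rad n = \<Prod>(prime_factors n)"

text \<open>
  The multiplicative order of an integer \<open>a\<close> modulo \<open>n\<close> is the library's \<^const>\<open>ord\<close> taken
  over \<^typ>\<open>int\<close>, so that the base may be negative. It has the junk value \<open>0\<close> if \<open>a\<close> is not
  coprime to \<open>n\<close>.
\<close>

definition calR :: "nat \<Rightarrow> int \<Rightarrow> int"
  where "calR n a = a ^ ord (int n) a - 1"

definition alpha :: "nat \<Rightarrow> int \<Rightarrow> nat"
  where "alpha n a = (if coprime a (int n) then ord (int n) (a ^ n) else 0)"

end

theory Submission
  imports Defs
begin

text \<open>
  Write \<open>e\<close> for the order of \<open>a\<close> modulo \<open>n2\<close> and \<open>x = a ^ e\<close>. Since \<open>n2\<close> divides \<open>x - 1\<close>, the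
  hypotheses give \<open>p dvd x - 1\<close> for all primes \<open>p dvd n1\<close>, and \<open>4 dvd x - 1\<close> if \<open>4 dvd n1\<close>. Under these
  conditions \<open>1 + x + \<dots> + x ^ (j - 1)\<close> can be replaced by \<open>j\<close> in divisibility statements modulo \<open>n1\<close>
  (a valuation-free form of lifting the exponent), so \<open>n1 dvd x ^ j - 1\<close> iff \<open>n1 dvd (x - 1) * j\<close>.
  Hence the order of \<open>a\<close> modulo \<open>n1\<close> is \<open>e * n1 / gcd n1 (x - 1)\<close>, and what remains is a computation
  with greatest common divisors.
\<close>

section \<open>Orders of possibly negative integers and of their powers\<close>

lemma rel_ord_int:
  assumes "n > 0"
  shows "[a ^ d = 1] (mod int n) \<longleftrightarrow> [nat (a mod int n) ^ d = 1] (mod n)"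
    and "ord (int n) a = ord n (nat (a mod int n))"
proof -
  have "[a ^ d = 1] (mod int n) \<longleftrightarrow> [nat (a mod int n) ^ d = 1] (mod n)" for d
    using assms by (simp flip: cong_int_iff add: cong_def power_mod)
  moreover have "coprime (int n) a \<longleftrightarrow> coprime n (nat (a mod int n))"
    using assms by (simp flip: coprime_int_iff)
  ultimately show "[a ^ d = 1] (mod int n) \<longleftrightarrow> [nat (a mod int n) ^ d = 1] (mod n)"
    "ord (int n) a = ord n (nat (a mod int n))"
    by (simp_all add: ord_def)
qed

lemma ord_int_dvd_iff:
  assumes "n > 0"
  shows "ord (int n) a dvd d \<longleftrightarrow> int n dvd a ^ d - 1"
  by (simp add: rel_ord_int[OF assms] flip: ord_divides cong_iff_dvd_diff)

lemma ord_int_pos: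
  assumes "n > 0" "coprime a (int n)"
  shows "ord (int n) a > 0"
  using assms unfolding rel_ord_int(2)[OF assms(1)]
  by (simp flip: coprime_int_iff add: coprime_commute)

text \<open>The order of an \<open>n\<close>-th power is the order of the base divided by its gcd
  with \<open>n\<close>; the product form avoids division on \<open>nat\<close>.\<close>

lemma alpha_mult_gcd:
  assumes "n > 0" "coprime a (int n)"
  shows "alpha n a * gcd n (ord (int n) a) = ord (int n) a"
proof -
  have "nat (a ^ n mod int n) = nat (a mod int n) ^ n mod n"
    using assms(1) by (simp flip: int_int_eq add: zmod_int power_mod)
  then show ?thesis
    using assms by (simp add: alpha_def rel_ord_int(2) ord_power_aux)
qed

section \<open>Geometric sums modulo primes and their squares\<close>

lemma geometric_sum_cong:
  fixes x :: int
  assumes "[x = 1] (mod m)"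
  shows "[(\<Sum>i<k. x ^ i) = int k] (mod m)"
proof -
  have "[(\<Sum>i<k. x ^ i) = (\<Sum>i<k. 1)] (mod m)"
    using assms by (intro cong_sum) (metis cong_pow power_one)
  then show ?thesis by simp
qed

lemma geometric_sum_mult:
  fixes x :: "'a::comm_ring_1"
  shows "(\<Sum>i<k * j. x ^ i) = (\<Sum>i<j. x ^ i) * (\<Sum>i<k. (x ^ j) ^ i)"
proof -
  have "(\<Sum>i<k * j. x ^ i) = (\<Sum>l<k. \<Sum>i = l * j..<l * j + j. x ^ i)"
    by (simp add: sum.nat_group)
  also have "\<dots> = (\<Sum>l<k. (x ^ j) ^ l * (\<Sum>i<j. x ^ i))"
  proof (rule sum.cong)
    fix l
    have "(\<Sum>i = l * j..<l * j + j. x ^ i) = (\<Sum>i<j. x ^ (i + l * j))"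
      using sum.shift_bounds_nat_ivl[of "\<lambda>i. x ^ i" 0 "l * j" j]
      by (simp add: lessThan_atLeast0 add.commute)
    then show "(\<Sum>i = l * j..<l * j + j. x ^ i) = (x ^ j) ^ l * (\<Sum>i<j. x ^ i)"
      by (simp add: power_add power_mult[symmetric] sum_distrib_right mult.commute)
  qed simp
  finally show ?thesis by (simp add: sum_distrib_left mult.commute)
qed

text \<open>The prime \<open>q\<close> divides the sum exactly once. With \<open>t = x - 1\<close>,
  \<open>x ^ i\<close> is \<open>1 + i * t\<close> modulo \<open>t\<^sup>2\<close>, so the sum is
  \<open>q + t * (0 + 1 + ... + (q - 1))\<close> modulo \<open>q\<^sup>2\<close>, and the second
  term vanishes there.\<close>

lemma geometric_sum_prime:
  fixes x :: int
  assumes q: "prime q" and "int q dvd x - 1" and "q = 2 \<Longrightarrow> 4 dvd x - 1"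
  obtains u where "(\<Sum>i<q. x ^ i) = int q * u" and "coprime u (int q)"
proof -
  define t where "t = x - 1"
  have sq: "(int q)\<^sup>2 dvd t\<^sup>2"
    using assms by (simp add: t_def)
  have expand: "[x ^ i = 1 + int i * t] (mod t\<^sup>2)" for i
  proof (induction i)
    case (Suc i)
    have "[x * x ^ i = x * (1 + int i * t)] (mod t\<^sup>2)"
      using Suc by (rule cong_scalar_left)
    also have "x * (1 + int i * t) = 1 + int (Suc i) * t + int i * t\<^sup>2"
      by (simp add: t_def algebra_simps power2_eq_square)
    also have "[\<dots> = 1 + int (Suc i) * t] (mod t\<^sup>2)"
      by (simp add: cong_iff_dvd_diff)
    finally show ?case by simp
  qed simp
  have "[(\<Sum>i<q. x ^ i) = (\<Sum>i<q. 1 + int i * t)] (mod (int q)\<^sup>2)"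
    by (intro cong_sum cong_dvd_modulus[OF expand sq])
  also have "(\<Sum>i<q. 1 + int i * t) = int q + t * (\<Sum>i<q. int i)"
    by (simp add: sum.distrib sum_distrib_left mult.commute)
  also have "[\<dots> = int q] (mod (int q)\<^sup>2)"
  proof -
    have "(int q)\<^sup>2 dvd t * (\<Sum>i<q. int i)"
    proof (cases "q = 2")
      case True
      \<comment> \<open>For \<open>q = 2\<close> the sum of indices is \<open>1\<close>, so both
        factors 2 must come from \<open>t\<close>.\<close>
      then show ?thesis using assms by (simp add: t_def numeral_2_eq_2)
    next
      case False
      then have "odd q" using prime_ge_2_nat[OF q] by (intro prime_odd_nat[OF q]) auto
      then obtain r where r: "q = 2 * r + 1" by (elim oddE)
      have "(\<Sum>i<2 * r + 1. int i) = int (2 * r + 1) * int r"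
        by (induction r) (simp_all add: algebra_simps)
      then have "int q dvd (\<Sum>i<q. int i)" unfolding r by simp
      then show ?thesis using assms by (auto simp: t_def power2_eq_square intro: mult_dvd_mono)
    qed
    then show ?thesis by (simp add: cong_iff_dvd_diff)
  qed
  finally obtain w where "(\<Sum>i<q. x ^ i) - int q = (int q)\<^sup>2 * w"
    by (auto simp: cong_iff_dvd_diff)
  then have "(\<Sum>i<q. x ^ i) = int q * (1 + int q * w)"
    by (simp add: algebra_simps power2_eq_square)
  moreover have "coprime (1 + int q * w) (int q)"
    by (rule coprimeI) (metis dvd_add_left_iff dvd_mult2)
  ultimately show ?thesis using that by blast
qed

section \<open>Lifting the exponent for a composite modulus\<close>

text \<open>These conditions pass from \<open>x\<close> to its powers, so the locale can be
  interpreted again at \<open>x ^ j\<close> inside an induction.\<close>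

locale lifting_base =
  fixes n :: nat and x :: int
  assumes n_pos: "n > 0"
    and prime_dvd: "prime p \<Longrightarrow> p dvd n \<Longrightarrow> int p dvd x - 1"
    and four_dvd: "4 dvd n \<Longrightarrow> 4 dvd x - 1"
begin

lemma lifting_base_power: "lifting_base n (x ^ j)"
proof
  have "x - 1 dvd x ^ j - 1" by (simp add: power_diff_1_eq)
  then show "prime p \<Longrightarrow> p dvd n \<Longrightarrow> int p dvd x ^ j - 1" "4 dvd n \<Longrightarrow> 4 dvd x ^ j - 1" for p
    using prime_dvd four_dvd dvd_trans by blast+
qed (rule n_pos)

lemma prime_not_dvd_geometric_sum:
  assumes "prime p" "p dvd n" "prime q" "p \<noteq> q"
  shows "\<not> int p dvd (\<Sum>i<q. x ^ i)"
proof -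
  have "[(\<Sum>i<q. x ^ i) = int q] (mod int p)"
    using prime_dvd[OF assms(1,2)] by (intro geometric_sum_cong) (simp add: cong_iff_dvd_diff)
  then show ?thesis
    using assms by (simp add: cong_dvd_iff primes_dvd_imp_eq)
       (metis primes_dvd_imp_eq)
qed

text \<open>A prime of \<open>n\<close> other than \<open>q\<close> does not divide the sum, and
  \<open>q\<close> divides it as often as it divides \<open>q\<close> itself. Only for
  \<open>q = 2\<close> can the sum contain further factors 2, and then \<open>n\<close> has just one
  to absorb.\<close>

lemma dvd_geometric_sum_prime_iff:
  assumes q: "prime q"
  shows "int n dvd c * (\<Sum>i<q. x ^ i) \<longleftrightarrow> int n dvd c * int q"
proof -
  define S where "S = (\<Sum>i<q. x ^ i)"
  \<comment> \<open>A common prime of \<open>m\<close> and \<open>s\<close> divides both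
    \<open>n\<close> and \<open>S\<close>, hence equals \<open>q\<close>, which the last premise
    excludes.\<close>
  have coprimeI: "coprime (int m) s"
    if "m dvd n" "s dvd S" "q dvd m \<Longrightarrow> \<not> int q dvd s" for m s
  proof (rule ccontr)
    assume "\<not> coprime (int m) s"
    then have "gcd m (nat \<bar>s\<bar>) \<noteq> 1"
      by (metis coprime_iff_gcd_eq_1 coprime_int_iff coprime_abs_right_iff int_nat_eq abs_ge_zero)
    then obtain p where "prime p" "p dvd gcd m (nat \<bar>s\<bar>)"
      using prime_factor_nat by blast
    then have p: "prime p" "p dvd m" "p dvd nat \<bar>s\<bar>"
      by (meson dvd_trans gcd_dvd1 gcd_dvd2)+
    then have "int p dvd s" by simp
    then have "int p dvd S" "p dvd n" using that(1,2) p(2) by (auto intro: dvd_trans)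
    then have "p = q"
      using prime_not_dvd_geometric_sum[OF p(1) _ q] unfolding S_def by blast
    with p that(3) \<open>int p dvd s\<close> show False by blast
  qed
  have "int n dvd c * S \<longleftrightarrow> int n dvd c * int q"
  proof (cases "q dvd n")
    case False
    then have "coprime (int n) (int q)"
      using prime_imp_coprime[OF q] by (simp add: coprime_commute)
    moreover have "coprime (int n) S" using False by (intro coprimeI) auto
    ultimately show ?thesis by (simp add: coprime_dvd_mult_left_iff)
  next
    case True
    show ?thesis
    proof (cases "q = 2 \<and> \<not> 4 dvd n")
      case False
      with True q prime_dvd four_dvd obtain u
        where u: "S = int q * u" "coprime u (int q)"
        unfolding S_def by (metis geometric_sum_prime)
      have "\<not> int q dvd u"
        using u(2) q coprime_common_divisor[of u "int q" "int q"] by auto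
      then have "coprime (int n) u" using u(1) by (intro coprimeI) auto
      then show ?thesis unfolding u(1)
        by (metis coprime_dvd_mult_left_iff mult.assoc)
    next
      case two: True
      with True obtain m where m: "n = 2 * m" by auto
      then have "odd m" using two by auto
      have "odd x" using prime_dvd[of 2] True two by simp
      then have "even S" using two by (simp add: S_def lessThan_nat_numeral)
      \<comment> \<open>\<open>S\<close> and 2 are both even and coprime to \<open>m\<close>, so
        both sides of the claim amount to \<open>m dvd c\<close>.\<close>
      have "coprime (int m) S" using \<open>odd m\<close> two m by (intro coprimeI) auto
      moreover have "coprime (int m) 2" using \<open>odd m\<close> by simp
      ultimately show ?thesis
        using \<open>even S\<close> two unfolding m
        by (auto simp: mult.commute[of 2] coprime_dvd_mult_left_iff intro: divides_mult
             dest: dvd_mult_left)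
    qed
  qed
  then show ?thesis by (simp add: S_def)
qed

text \<open>Peels primes off \<open>j\<close>: a sum of length \<open>q * j\<close> factors into one
  of length \<open>j\<close> in \<open>x\<close> and one of length \<open>q\<close> in
  \<open>x ^ j\<close>. The factor \<open>c\<close> is arbitrary so that it can absorb the other
  sum.\<close>

lemma dvd_geometric_sum_iff:
  "int n dvd c * (\<Sum>i<j. x ^ i) \<longleftrightarrow> int n dvd c * int j"
proof (induction j arbitrary: c rule: prime_divisors_induct)
  case (factor q j)
  interpret xj: lifting_base n "x ^ j" by (rule lifting_base_power)
  have "int n dvd c * (\<Sum>i<q * j. x ^ i)
      \<longleftrightarrow> int n dvd (c * (\<Sum>i<j. x ^ i)) * (\<Sum>i<q. (x ^ j) ^ i)"
    by (simp add: geometric_sum_mult mult.assoc)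
  also have "\<dots> \<longleftrightarrow> int n dvd (c * int q) * (\<Sum>i<j. x ^ i)"
    using xj.dvd_geometric_sum_prime_iff[OF factor(1), of "c * (\<Sum>i<j. x ^ i)"]
    by (simp only: mult_ac)
  also have "\<dots> \<longleftrightarrow> int n dvd (c * int q) * int j" by (rule factor(2))
  finally show ?case by (simp add: mult.assoc)
qed simp_all

text \<open>Factor \<open>x ^ j - 1\<close> as \<open>x - 1\<close> times a geometric sum, replace
  the sum by \<open>j\<close>, and cancel the gcd.\<close>

lemma dvd_power_diff_1_iff:
  "int n dvd x ^ j - 1 \<longleftrightarrow> n div nat (gcd (int n) (x - 1)) dvd j"
proof -
  define g where "g = gcd (int n) (x - 1)"
  have g: "g > 0" using n_pos by (simp add: g_def)
  obtain m y where m: "int n = g * m" and y: "x - 1 = g * y" and "coprime m y"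
    using n_pos gcd_coprime_exists[of "int n" "x - 1"] unfolding g_def
    by (metis gcd_eq_0_iff mult.commute of_nat_0_eq_iff not_gr_zero)
  have "int n dvd x ^ j - 1 \<longleftrightarrow> int n dvd (x - 1) * int j"
    by (simp add: power_diff_1_eq dvd_geometric_sum_iff)
  also have "\<dots> \<longleftrightarrow> m dvd y * int j"
    using g unfolding m y by (simp add: mult.assoc)
  also have "\<dots> \<longleftrightarrow> m dvd int j"
    using \<open>coprime m y\<close> by (simp add: coprime_dvd_mult_right_iff)
  also have "m = int (n div nat g)"
    using g m by (simp add: zdiv_int)
  finally show ?thesis by (simp add: g_def)
qed

end

section \<open>Comparing the two moduli\<close>

text \<open>Since \<open>n2 dvd n1\<close>, every admissible exponent is a multiple
  \<open>e * j\<close>, and lifting applied to \<open>a ^ e\<close> decides which \<open>j\<close>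
  occur.\<close>

lemma ord_eq_mult_div_gcd:
  assumes "n1 > 0" "n2 > 0" "n2 dvd n1" "coprime a (int n1)"
    and "lifting_base n1 (a ^ ord (int n2) a)"
  shows "ord (int n1) a = ord (int n2) a * (n1 div nat (gcd (int n1) (calR n2 a)))"
proof -
  define e where "e = ord (int n2) a"
  have "coprime a (int n2)"
    using assms(3,4) by (meson coprime_divisors dvd_refl int_dvd_int_iff)
  then have "e > 0" using assms(2) by (simp add: e_def ord_int_pos)
  have "ord (int n1) a dvd k \<longleftrightarrow> e * (n1 div nat (gcd (int n1) (calR n2 a))) dvd k" for k
  proof (cases "e dvd k")
    case True
    then obtain j where k: "k = e * j" by blast
    have "ord (int n1) a dvd k \<longleftrightarrow> int n1 dvd (a ^ e) ^ j - 1"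
      using assms(1) by (simp add: ord_int_dvd_iff k power_mult)
    then show ?thesis
      using lifting_base.dvd_power_diff_1_iff[OF assms(5)] \<open>e > 0\<close>
      by (simp add: k calR_def flip: e_def)
  next
    case False
    then have "\<not> int n2 dvd a ^ k - 1" using assms(2) by (simp add: e_def ord_int_dvd_iff)
    then have "\<not> int n1 dvd a ^ k - 1"
      using assms(3) by (meson dvd_trans int_dvd_int_iff)
    with False show ?thesis using assms(1) by (auto simp: ord_int_dvd_iff dest: dvd_mult_left)
  qed
  then show ?thesis unfolding e_def[symmetric] by (meson dvd_antisym dvd_refl)
qed

lemma prime_dvd_rad: "n > 0 \<Longrightarrow> prime p \<Longrightarrow> p dvd n \<Longrightarrow> p dvd rad n"
  unfolding rad_def by (intro dvd_prodI) (auto simp: prime_factors_dvd)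

text \<open>The arithmetic left over once \<open>n1 = n2 * h * m\<close> has order
  \<open>e * m\<close>. Dividing by \<open>gcd n2 e\<close> makes \<open>\<alpha>2\<close> coprime
  to what remains of \<open>n2\<close>, so only \<open>h\<close> contributes to the gcd.\<close>

lemma quotient_gcd_identity:
  fixes \<alpha>1 \<alpha>2 n2 h m e :: nat
  assumes pos: "n2 > 0" "h > 0" "m > 0" "e > 0"
    and \<alpha>1: "\<alpha>1 * gcd (n2 * h * m) (e * m) = e * m"
    and \<alpha>2: "\<alpha>2 * gcd n2 e = e"
  shows "\<alpha>1 * gcd \<alpha>2 h = \<alpha>2"
proof -
  define d where "d = gcd n2 e"
  have "d > 0" using pos by (simp add: d_def)
  obtain s where s: "n2 = d * s" by (metis d_def gcd_dvd1 dvdE)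
  have e: "e = d * \<alpha>2" using \<alpha>2 by (simp add: d_def mult.commute)
  have "d * gcd s \<alpha>2 = d" using s e d_def by (metis gcd_mult_distrib_nat)
  then have "gcd s \<alpha>2 = 1" using \<open>d > 0\<close> by simp
  then have "coprime \<alpha>2 s" by (metis coprime_iff_gcd_eq_1 gcd.commute)
  have "gcd (n2 * h * m) (e * m) = d * m * gcd (s * h) \<alpha>2"
    using gcd_mult_distrib_nat[of "d * m" "s * h" \<alpha>2] by (simp add: s e mult_ac)
  also have "gcd (s * h) \<alpha>2 = gcd \<alpha>2 h"
    using \<open>coprime \<alpha>2 s\<close> by (simp add: gcd_mult_right_left_cancel gcd.commute)
  finally have "(d * m) * (\<alpha>1 * gcd \<alpha>2 h) = (d * m) * \<alpha>2"
    using \<alpha>1 e by (simp add: mult_ac)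
  then show ?thesis using \<open>d > 0\<close> pos by simp
qed

theorem theorem2p5:
  fixes n1 n2 :: nat and a :: int
  assumes "n1 > 0" and "n2 > 0"
    and "multiplicity 2 n1 \<le> 1 \<longrightarrow> rad n1 dvd n2 \<and> n2 dvd n1"
    and "multiplicity 2 n1 \<ge> 2 \<longrightarrow> 2 * rad n1 dvd n2 \<and> n2 dvd n1"
    and "coprime a (int n1)" and "coprime a (int n2)"
  shows "real (alpha n1 a) =
    real (alpha n2 a) /
      real_of_int (gcd (int (alpha n2 a)) (gcd (int n1) (calR n2 a) div int n2))"
proof -
  define e where "e = ord (int n2) a"
  define g where "g = nat (gcd (int n1) (calR n2 a))"
  have rad: "rad n1 dvd n2" and n2: "n2 dvd n1"
    using assms(3,4) by (cases "multiplicity 2 n1 \<le> 1"; auto dest: dvd_mult_right)+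
  have R: "int n2 dvd a ^ e - 1"
    using assms(2) by (simp add: e_def flip: ord_int_dvd_iff)
  have "lifting_base n1 (a ^ e)"
  proof
    show "int p dvd a ^ e - 1" if "prime p" "p dvd n1" for p
      using prime_dvd_rad[OF assms(1) that] rad R by (meson dvd_trans int_dvd_int_iff)
    show "4 dvd a ^ e - 1" if "4 dvd n1"
    proof -
      have "(2::nat) ^ 2 dvd n1" using that by simp
      then have "multiplicity 2 n1 \<ge> 2"
        using assms(1) by (intro multiplicity_geI) auto
      then have "2 * rad n1 dvd n2" using assms(4) by blast
      moreover have "2 dvd rad n1"
        using that assms(1) by (intro prime_dvd_rad) (auto intro: dvd_trans[of 2 4])
      \<comment> \<open>The extra factor 2 in the hypothesis, next to the one in
        \<open>rad n1\<close>, supplies the condition at 4.\<close>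
      ultimately have "2 * 2 dvd n2" by (meson dvd_trans mult_dvd_mono dvd_refl)
      then have "int 4 dvd int n2" by (simp add: int_dvd_int_iff del: of_nat_numeral)
      then show ?thesis using R by (auto intro: dvd_trans)
    qed
  qed (rule assms(1))
  then have ord1: "ord (int n1) a = e * (n1 div g)"
    using ord_eq_mult_div_gcd[OF assms(1,2) n2 assms(5)] by (simp add: e_def g_def)
  have "g dvd n1" "n2 dvd g"
    using R n2 by (simp_all add: g_def calR_def e_def flip: int_dvd_int_iff)
  \<comment> \<open>\<open>h\<close> is the inner quotient of the claimed formula, and
    \<open>m\<close> is the factor by which the order grows.\<close>
  then obtain m h where gm: "n1 = g * m" and gh: "g = n2 * h" by blast
  have pos: "h > 0" "m > 0" "g > 0" using assms(1) gm gh by (auto intro!: Nat.gr0I)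
  have "e > 0" using assms by (simp add: e_def ord_int_pos)
  have "alpha n1 a * gcd (n2 * h * m) (e * m) = e * m"
    using alpha_mult_gcd[OF assms(1,5)] ord1 pos by (simp add: gm gh)
  then have main: "alpha n1 a * gcd (alpha n2 a) h = alpha n2 a"
    using alpha_mult_gcd[OF assms(2,6)] pos \<open>e > 0\<close> assms(2)
    by (intro quotient_gcd_identity[of n2 h m e]) (auto simp: e_def)
  have "gcd (int n1) (calR n2 a) = int (n2 * h)" by (simp flip: gh add: g_def)
  then have "gcd (int (alpha n2 a)) (gcd (int n1) (calR n2 a) div int n2)
      = int (gcd (alpha n2 a) h)"
    using assms(2) by (simp add: gcd_int_int_eq)
  then show ?thesis
    using pos arg_cong[OF main, of real] by (simp add: field_simps)
qed

end
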